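(* Let $T$ be a tree with at least two edges. Then $\mu(L(T))=\mu(T)$.
   Context: All graphs are finite, simple, undirected and connected. A tree is a connected graph with no cycles. For a graph $G$ and $X\subseteq V(G)$, two vertices $u,v$ are $X$-visible if there is a shortest $(u,v)$-path in $G$ all of whose internal vertices lie outside $X$. A set $X\subseteq V(G)$ is a mutual-visibility set of $G$ if every pair of vertices of $X$ is $X$-visible. The mutual-visibility number $\mu(G)$ is the maximum cardinality of a mutual-visibility set of $G$. The line graph $L(G)$ has vertex set $E(G)$, two vertices being adjacent if and only if the corresponding (distinct) edges of $G$ share an endpoint. *)

theory Defs
  imports "Graph_Theory.Graph_Theory"
begin

text \<open>
  Finite simple undirected graphs are represented by \<^locale>\<open>pair_graph\<close>: finite, loop-free,
  symmetric digraphs without parallel arcs, so that an undirected edge with endpoints \<open>u\<close> and \<open>v\<close>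
  corresponds to the two arcs \<open>(u, v)\<close> and \<open>(v, u)\<close>.
\<close>

definition edges :: "'a pair_pre_digraph \<Rightarrow> 'a set set" where
  "edges G = {{u, v} | u v. (u, v) \<in> parcs G}"

text \<open>
  The library's \<^const>\<open>forest\<close> and \<^const>\<open>tree\<close> forbid directed cycles, and in a symmetric digraph
  the walk \<open>u, v, u\<close> along a single edge already is one. Cycles of undirected graphs are therefore
  required to have at least three vertices.
\<close>

definition undirected_cycle :: "'a pair_pre_digraph \<Rightarrow> 'a list \<Rightarrow> bool" where
  "undirected_cycle G c \<longleftrightarrow> vpath c G \<and> 3 \<le> length c \<and> (last c, hd c) \<in> parcs G"

definition undirected_tree :: "'a pair_pre_digraph \<Rightarrow> bool" where
  "undirected_tree G \<longleftrightarrow>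
     pair_graph G \<and> Digraph_Component.connected G \<and> (\<nexists>c. undirected_cycle G c)"

definition shortest_path :: "'a pair_pre_digraph \<Rightarrow> 'a \<Rightarrow> 'a list \<Rightarrow> 'a \<Rightarrow> bool" where
  "shortest_path G u p v \<longleftrightarrow>
     vpath p G \<and> hd p = u \<and> last p = v \<and>
     (\<forall>q. vpath q G \<and> hd q = u \<and> last q = v \<longrightarrow> vwalk_length p \<le> vwalk_length q)"

definition internal_verts :: "'a list \<Rightarrow> 'a set" where
  "internal_verts p = set (butlast (tl p))"

definition visible :: "'a pair_pre_digraph \<Rightarrow> 'a set \<Rightarrow> 'a \<Rightarrow> 'a \<Rightarrow> bool" where
  "visible G X u v \<longleftrightarrow> (\<exists>p. shortest_path G u p v \<and> internal_verts p \<inter> X = {})"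

definition mutual_visibility_set :: "'a pair_pre_digraph \<Rightarrow> 'a set \<Rightarrow> bool" where
  "mutual_visibility_set G X \<longleftrightarrow> X \<subseteq> pverts G \<and> (\<forall>u\<in>X. \<forall>v\<in>X. visible G X u v)"

definition mutual_visibility_number :: "'a pair_pre_digraph \<Rightarrow> nat" where
  "mutual_visibility_number G = Max {card X | X. mutual_visibility_set G X}"

definition line_graph :: "'a pair_pre_digraph \<Rightarrow> 'a set pair_pre_digraph" where
  "line_graph G =
     \<lparr> pverts = edges G,
       parcs = {(e, f). e \<in> edges G \<and> f \<in> edges G \<and> e \<noteq> f \<and> e \<inter> f \<noteq> {}} \<rparr>"

lemma mutual_visibility_cards:
  assumes "pair_graph G"
  shows "finite {card X | X. mutual_visibility_set G X}"
    and "{card X | X. mutual_visibility_set G X} \<noteq> {}"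
proof -
  interpret pair_graph G by fact
  have "{card X | X. mutual_visibility_set G X} \<subseteq> card ` Pow (pverts G)"
    by (auto simp: mutual_visibility_set_def)
  then show "finite {card X | X. mutual_visibility_set G X}"
    by (rule finite_subset) (simp add: pair_finite_verts)
  have "mutual_visibility_set G {}"
    by (simp add: mutual_visibility_set_def)
  then show "{card X | X. mutual_visibility_set G X} \<noteq> {}"
    by blast
qed

lemma pair_graph_line_graph:
  assumes "pair_graph G"
  shows "pair_graph (line_graph G)"
proof -
  interpret pair_graph G by fact
  have "edges G = (\<lambda>(u, v). {u, v}) ` parcs G"
    by (auto simp: edges_def)
  then have fin: "finite (edges G)"
    by (simp add: pair_finite_arcs)
  have "parcs (line_graph G) \<subseteq> edges G \<times> edges G"
    by (auto simp: line_graph_def)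
  then have "finite (parcs (line_graph G))"
    by (rule finite_subset) (simp add: fin)
  then show ?thesis
    by unfold_locales
      (use fin in \<open>auto simp: line_graph_def Digraph.symmetric_def sym_def\<close>)
qed

end

theory Submission
  imports Defs
begin

text \<open>
  In a block graph, two neighbours of \<open>x\<close> that can be joined avoiding \<open>x\<close> are adjacent. Both \<open>T\<close> and
  \<open>L(T)\<close> are block graphs, and in a block graph \<open>\<mu>\<close> is the number of simplicial vertices. These are
  pairwise visible, since a shortest path can be short-cut at a simplicial inner vertex. Conversely,
  for a member \<open>x\<close> of a mutual-visibility set \<open>X\<close> and another member \<open>y\<close>, among the vertices separated
  from \<open>y\<close> by \<open>x\<close> one with the most separating vertices from \<open>y\<close> is simplicial; it is separated by
  \<open>x\<close> from all of \<open>X\<close>, and therefore determines \<open>x\<close>. Finally, with at least two edges, the leaves of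
  \<open>T\<close> correspond to its pendant edges, which are the simplicial vertices of \<open>L(T)\<close>.
\<close>

section \<open>Walks and separating vertices\<close>

lemma rtrancl_imp_vpath:
  assumes "(u, v) \<in> S\<^sup>*" and "S \<subseteq> parcs G" and "pair_wf_digraph G" and "u \<in> pverts G"
  obtains p where "vpath p G" and "hd p = u" and "last p = v"
    and "set (vwalk_arcs p) \<subseteq> S" and "set p \<subseteq> insert u (Range S)"
proof -
  \<comment> \<open>The walk is built and shortened inside an auxiliary graph with arc set
    \<open>S\<close>, so the resulting path uses arcs of \<open>S\<close> only; \<open>u\<close> is
    added to its vertices for the trivial walk.\<close>
  let ?H = "\<lparr>pverts = insert u (Range S), parcs = S\<rparr>"
  interpret pair_wf_digraph G by fact
  have "\<exists>p. vwalk p ?H \<and> hd p = u \<and> last p = v"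
    using assms(1)
  proof induction
    case base
    have "vwalk [u] ?H" by simp
    then show ?case by (metis last_ConsL list.sel(1))
  next
    case (step y z)
    then obtain p where p: "vwalk p ?H" "hd p = u" "last p = y" by blast
    then have "p \<noteq> []" by (auto simp: vwalk_def)
    with p step have "vwalk (p @ [z]) ?H"
      by (auto simp: vwalk_def set_vwalk_arcs_snoc)
    with p \<open>p \<noteq> []\<close> show ?case by (metis hd_append2 last_snoc)
  qed
  then obtain p where p: "vpath p ?H" "hd p = u" "last p = v"
    using vwalk_imp_ex_vpath by metis
  moreover have "insert u (Range S) \<subseteq> pverts G"
    using assms(2,4) in_arcsD2 by blast
  ultimately have "vpath p G"
    using assms(2) by (auto simp: vpath_def vwalk_def)
  with p that show ?thesis by (auto simp: vpath_def vwalk_def)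
qed

lemma vwalk_arcs_imp_rtrancl:
  assumes "p \<noteq> []" and "set (vwalk_arcs p) \<subseteq> S"
  shows "(hd p, last p) \<in> S\<^sup>*"
  using assms
  by (induction p rule: vwalk_arcs.induct) (auto intro: converse_rtrancl_into_rtrancl)

lemma set_subset_internal_verts: "set p \<subseteq> {hd p, last p} \<union> internal_verts p"
proof (cases p)
  case (Cons a q)
  then show ?thesis
    by (cases q rule: rev_cases) (auto simp: internal_verts_def)
qed simp

section \<open>Separation by a vertex, and simplicial vertices on shortest paths\<close>

definition avoiding :: "'a pair_pre_digraph \<Rightarrow> 'a \<Rightarrow> 'a rel" where
  "avoiding G x = {(a, b) \<in> parcs G. a \<noteq> x \<and> b \<noteq> x}"

text \<open>Endpoints count as separating, so for fixed \<open>a\<close> this is the dominator order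
  rooted at \<open>a\<close>: every walk from \<open>a\<close> to \<open>b\<close> meets
  \<open>x\<close>.\<close>

definition separates :: "'a pair_pre_digraph \<Rightarrow> 'a \<Rightarrow> 'a \<Rightarrow> 'a \<Rightarrow> bool" where
  "separates G x a b \<longleftrightarrow> x = a \<or> x = b \<or> (a, b) \<notin> (avoiding G x)\<^sup>*"

definition simplicial_verts :: "'a pair_pre_digraph \<Rightarrow> 'a set" where
  "simplicial_verts G =
     {x \<in> pverts G. \<forall>y z. (x, y) \<in> parcs G \<longrightarrow> (x, z) \<in> parcs G \<longrightarrow> y = z \<or> (y, z) \<in> parcs G}"

lemma avoiding_subset: "avoiding G x \<subseteq> parcs G"
  by (auto simp: avoiding_def)

text \<open>A walk from \<open>a\<close> that avoids \<open>z\<close> never reaches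
  \<open>l\<close>, so it avoids \<open>l\<close> as well and cannot end in
  \<open>b\<close>.\<close>

lemma separates_trans:
  assumes "separates G z a l" and "separates G l a b"
  shows "separates G z a b"
proof (rule ccontr)
  assume "\<not> separates G z a b"
  then have z: "z \<noteq> a" "z \<noteq> b" "(a, b) \<in> (avoiding G z)\<^sup>*"
    by (auto simp: separates_def)
  then have l: "l \<noteq> a" "l \<noteq> b" "z \<noteq> l" "(a, b) \<notin> (avoiding G l)\<^sup>*" "(a, l) \<notin> (avoiding G z)\<^sup>*"
    using assms by (auto simp: separates_def)
  have "c \<noteq> l \<and> (a, c) \<in> (avoiding G l)\<^sup>*" if "(a, c) \<in> (avoiding G z)\<^sup>*" for c
    using that
  proof induction
    case base
    then show ?case using l by simp
  next
    case (step c d)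
    have "d \<noteq> l"
      using step.hyps l(5) by (blast intro: rtrancl_into_rtrancl)
    moreover have "(c, d) \<in> avoiding G l"
      using step \<open>d \<noteq> l\<close> by (auto simp: avoiding_def)
    ultimately show ?case using step.IH by (blast intro: rtrancl_into_rtrancl)
  qed
  with z l show False by blast
qed

text \<open>On a walk from \<open>a\<close> to \<open>x\<close>, whichever of \<open>x\<close> and
  \<open>y\<close> comes first would be reached without meeting the other.\<close>

lemma separates_antisym:
  assumes "separates G x a y" and "separates G y a x" and "(a, x) \<in> (parcs G)\<^sup>*"
  shows "x = y"
proof (rule ccontr)
  assume "x \<noteq> y"
  then have neq: "x \<noteq> a" "y \<noteq> a"
    and sep: "(a, y) \<notin> (avoiding G x)\<^sup>*" "(a, x) \<notin> (avoiding G y)\<^sup>*"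
    using assms by (auto simp: separates_def)
  have "c \<noteq> x \<and> c \<noteq> y \<and> (a, c) \<in> (avoiding G x)\<^sup>* \<and> (a, c) \<in> (avoiding G y)\<^sup>*"
    if "(a, c) \<in> (parcs G)\<^sup>*" for c
    using that
  proof induction
    case base
    then show ?case using neq by simp
  next
    case (step c d)
    have x: "(a, d) \<in> (avoiding G x)\<^sup>*" if "d \<noteq> x"
      using step that by (auto simp: avoiding_def intro: rtrancl_into_rtrancl)
    have y: "(a, d) \<in> (avoiding G y)\<^sup>*" if "d \<noteq> y"
      using step that by (auto simp: avoiding_def intro: rtrancl_into_rtrancl)
    show ?case using x y sep \<open>x \<noteq> y\<close> by metis
  qed
  with assms(3) show False by blast
qed

text \<open>The upper bound uses visibility only in this form: two members of \<open>X\<close>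
  remain joined after deleting a third.\<close>

lemma visible_imp_not_separates:
  assumes "visible G X u v" and "x \<in> X" and "x \<noteq> u" and "x \<noteq> v"
  shows "\<not> separates G x u v"
proof -
  obtain p where p: "vwalk p G" "hd p = u" "last p = v" "internal_verts p \<inter> X = {}"
    using assms(1) by (auto simp: visible_def shortest_path_def vpath_def)
  have "x \<notin> set p"
    using set_subset_internal_verts[of p] p assms by auto
  then have "set (vwalk_arcs p) \<subseteq> avoiding G x"
    using p arcs_in_vwalk_arcs[of _ p] by (fastforce simp: avoiding_def vwalk_def)
  then show ?thesis
    using vwalk_arcs_imp_rtrancl[of p] p assms by (auto simp: separates_def vwalk_def)
qed

text \<open>The two neighbours of a simplicial inner vertex on the path are distinct, hence
  adjacent, and skipping the vertex shortens the path.\<close>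

lemma shortest_path_simplicial:
  assumes "pair_graph G" and "shortest_path G u p v"
  shows "internal_verts p \<inter> simplicial_verts G = {}"
proof (rule ccontr)
  interpret pair_graph G by fact
  assume "internal_verts p \<inter> simplicial_verts G \<noteq> {}"
  then obtain x where x: "x \<in> set (butlast (tl p))" "x \<in> simplicial_verts G"
    by (auto simp: internal_verts_def)
  obtain c d where cd: "butlast (tl p) = c @ x # d"
    using x(1) by (meson split_list)
  define as where "as = hd p # c"
  define bs where "bs = d @ [last p]"
  \<comment> \<open>A nonempty \<open>butlast (tl p)\<close> forces at least three vertices, so
    \<open>hd p\<close> and \<open>last p\<close> are different positions of the list.\<close>
  have "p = hd p # butlast (tl p) @ [last p]"
    using x(1) by (cases p; cases "tl p") auto
  then have p: "p = as @ x # bs"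
    by (simp add: cd as_def bs_def)
  have ne: "as \<noteq> []" "bs \<noteq> []"
    by (auto simp: as_def bs_def)
  have w: "vwalk p G" "distinct p"
    and min: "\<And>q. vpath q G \<Longrightarrow> hd q = u \<Longrightarrow> last q = v \<Longrightarrow> length p - 1 \<le> length q - 1"
    using assms(2) by (auto simp: shortest_path_def vpath_def)
  have hl: "hd p = u" "last p = v"
    using assms(2) by (auto simp: shortest_path_def)
  have arcs: "set (vwalk_arcs p) = set (vwalk_arcs as) \<union> {(last as, x), (x, hd bs)} \<union> set (vwalk_arcs bs)"
    using ne by (auto simp: p vwalk_arcs_append)
  then have "(last as, x) \<in> parcs G" "(x, hd bs) \<in> parcs G"
    using w by (auto simp: vwalk_def)
  moreover have "last as \<noteq> hd bs"
    using w(2) ne unfolding p by (auto dest: last_in_set hd_in_set)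
  ultimately have "(last as, hd bs) \<in> parcs G"
    using x(2) arcs_symmetric by (auto simp: simplicial_verts_def)
  then have "vpath (as @ bs) G"
    using w arcs ne by (auto simp: vpath_def vwalk_def vwalk_arcs_append p)
  then have "length p - 1 \<le> length (as @ bs) - 1"
    using ne hl by (intro min) (auto simp: p)
  with ne show False by (cases as) (auto simp: p)
qed

section \<open>Mutual visibility in block graphs\<close>

text \<open>\<open>neighbours_adjacent\<close> expresses that every block is a clique without
  speaking of blocks: two neighbours of \<open>x\<close> share a block with \<open>x\<close> exactly
  if they are joined avoiding \<open>x\<close>.\<close>

locale block_graph = pair_graph +
  assumes connected: "a \<in> pverts G \<Longrightarrow> b \<in> pverts G \<Longrightarrow> (a, b) \<in> (parcs G)\<^sup>*"
    and neighbours_adjacent: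
      "(x, y) \<in> parcs G \<Longrightarrow> (x, z) \<in> parcs G \<Longrightarrow> (y, z) \<in> (avoiding G x)\<^sup>* \<Longrightarrow> y \<noteq> z
        \<Longrightarrow> (y, z) \<in> parcs G"
    and nontrivial: "2 \<le> card (pverts G)"
begin

lemma avoiding_rtrancl_sym: "(a, b) \<in> (avoiding G x)\<^sup>* \<Longrightarrow> (b, a) \<in> (avoiding G x)\<^sup>*"
proof -
  have "sym (avoiding G x)"
    by (auto simp: avoiding_def sym_def arcs_symmetric)
  then show "(a, b) \<in> (avoiding G x)\<^sup>* \<Longrightarrow> (b, a) \<in> (avoiding G x)\<^sup>*"
    by (meson sym_rtrancl symD)
qed

text \<open>If a deepest vertex \<open>l\<close> in the dominator order had two nonadjacent
  neighbours, deleting \<open>l\<close> would put them in different components; one of them would be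
  cut off from \<open>a\<close> by \<open>l\<close> and lie strictly deeper.\<close>

lemma ex_simplicial_beyond:
  assumes "a \<in> pverts G" and "x \<in> pverts G" and "a \<noteq> x"
  obtains l where "l \<in> simplicial_verts G" and "separates G x a l"
proof -
  let ?S = "\<lambda>l. {z \<in> pverts G. separates G z a l}"
  have fin: "finite (?S l)" for l
    using pair_finite_verts by simp
  have "\<exists>l. (l \<in> pverts G \<and> separates G x a l) \<and>
      (\<forall>b. b \<in> pverts G \<and> separates G x a b \<longrightarrow> card (?S b) \<le> card (?S l))"
  proof (rule ex_has_greatest_nat)
    show "x \<in> pverts G \<and> separates G x a x"
      using assms by (simp add: separates_def)
    show "\<forall>b. b \<in> pverts G \<and> separates G x a b \<longrightarrow> card (?S b) < Suc (card (pverts G))"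
      using pair_finite_verts by (auto simp: less_Suc_eq_le intro: card_mono)
  qed
  then obtain l where l: "l \<in> pverts G" "separates G x a l"
    and max: "\<And>b. b \<in> pverts G \<Longrightarrow> separates G x a b \<Longrightarrow> card (?S b) \<le> card (?S l)"
    by blast
  have "l \<in> simplicial_verts G"
  proof (rule ccontr)
    assume "l \<notin> simplicial_verts G"
    then obtain y z where yz: "(l, y) \<in> parcs G" "(l, z) \<in> parcs G" "y \<noteq> z" "(y, z) \<notin> parcs G"
      using l by (auto simp: simplicial_verts_def)
    then have "(y, z) \<notin> (avoiding G l)\<^sup>*"
      using neighbours_adjacent by blast
    \<comment> \<open>Otherwise the connections from \<open>a\<close> to \<open>y\<close> and to
      \<open>z\<close> would together join \<open>y\<close> to \<open>z\<close> while avoiding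
      \<open>l\<close>.\<close>
    then have "separates G l a y \<or> separates G l a z"
      unfolding separates_def by (meson avoiding_rtrancl_sym rtrancl_trans)
    with yz obtain b where b: "(l, b) \<in> parcs G" "separates G l a b"
      by blast
    then have bV: "b \<in> pverts G" and "l \<noteq> b"
      using in_arcsD2 no_loops' by blast+
    \<comment> \<open>\<open>b\<close> dominates itself but not \<open>l\<close>, so the count
      increases strictly.\<close>
    have "\<not> separates G b a l"
      using separates_antisym[OF b(2)] connected assms(1) l(1) \<open>l \<noteq> b\<close> by blast
    moreover have "?S l \<subseteq> ?S b"
      using separates_trans[OF _ b(2)] by auto
    moreover have "b \<in> ?S b"
      using bV by (simp add: separates_def)
    ultimately have "card (?S l) < card (?S b)"
      by (intro psubset_card_mono fin) blast
    moreover have "card (?S b) \<le> card (?S l)"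
      using bV separates_trans[OF l(2) b(2)] by (intro max)
    ultimately show False by simp
  qed
  with l that show ?thesis by blast
qed

text \<open>Lower bound: any shortest path is a witness, since none has a simplicial inner
  vertex.\<close>

lemma mutual_visibility_set_simplicial: "mutual_visibility_set G (simplicial_verts G)"
proof -
  have "visible G (simplicial_verts G) u v" if "u \<in> pverts G" "v \<in> pverts G" for u v
  proof -
    have "(u, v) \<in> (parcs G)\<^sup>*"
      using that by (rule connected)
    then obtain p where "vpath p G \<and> hd p = u \<and> last p = v"
      using rtrancl_imp_vpath[OF _ subset_refl, of u v G] \<open>u \<in> pverts G\<close> pair_wf_digraph by metis
    then obtain p where "vpath p G \<and> hd p = u \<and> last p = v"
      and "\<forall>q. vpath q G \<and> hd q = u \<and> last q = v \<longrightarrow> vwalk_length p \<le> vwalk_length q"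
      using ex_has_least_nat[of "\<lambda>p. vpath p G \<and> hd p = u \<and> last p = v" p vwalk_length] by blast
    then have "shortest_path G u p v"
      by (simp add: shortest_path_def)
    then show ?thesis
      using shortest_path_simplicial[OF pair_graph] unfolding visible_def by blast
  qed
  then show ?thesis
    by (auto simp: mutual_visibility_set_def simplicial_verts_def)
qed

lemma card_mutual_visibility_set_le:
  assumes "mutual_visibility_set G X"
  shows "card X \<le> card (simplicial_verts G)"
proof -
  have fin: "finite (simplicial_verts G)"
    using pair_finite_verts by (simp add: simplicial_verts_def)
  have XV: "X \<subseteq> pverts G" and vis: "\<And>u v. u \<in> X \<Longrightarrow> v \<in> X \<Longrightarrow> visible G X u v"
    using assms by (auto simp: mutual_visibility_set_def)
  show ?thesis
  proof (cases "card X \<le> 1")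
    case True
    \<comment> \<open>Here \<open>X\<close> offers no second member to look from, and the existence
      of one simplicial vertex suffices.\<close>
    obtain a x where "a \<in> pverts G" "x \<in> pverts G" "a \<noteq> x"
      using nontrivial by (metis card_le_Suc0_iff_eq not_less_eq_eq numeral_2_eq_2 pair_finite_verts)
    then have "simplicial_verts G \<noteq> {}"
      using ex_simplicial_beyond by (metis empty_iff)
    then show ?thesis
      using True fin by (metis One_nat_def Suc_leI card_gt_0_iff le_trans)
  next
    case False
    have "\<exists>l \<in> simplicial_verts G. \<forall>y\<in>X. separates G x l y" if x: "x \<in> X" for x
    proof -
      have "\<exists>a\<in>X. a \<noteq> x"
        using False x by (metis One_nat_def card_le_Suc0_iff_eq card.infinite le0)
      then obtain a where a: "a \<in> X" "a \<noteq> x"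
        by blast
      obtain l where l: "l \<in> simplicial_verts G" "separates G x a l"
        using ex_simplicial_beyond[of a x] a x XV by blast
      \<comment> \<open>A connection from \<open>l\<close> to \<open>y\<close> avoiding
        \<open>x\<close> would extend to \<open>a\<close>, because visibility joins \<open>a\<close>
        and \<open>y\<close> off \<open>x\<close>.\<close>
      have "separates G x l y" if "y \<in> X" for y
      proof (rule ccontr)
        assume "\<not> separates G x l y"
        then have "x \<noteq> l" "x \<noteq> y" "(l, y) \<in> (avoiding G x)\<^sup>*"
          by (auto simp: separates_def)
        moreover have "(a, y) \<in> (avoiding G x)\<^sup>*"
          using visible_imp_not_separates[OF vis[OF a(1) \<open>y \<in> X\<close>] x] a \<open>x \<noteq> y\<close>
          by (auto simp: separates_def)
        ultimately show False
          using l(2) a(2) unfolding separates_def by (meson avoiding_rtrancl_sym rtrancl_trans)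
      qed
      with l show ?thesis by blast
    qed
    then obtain f where f: "\<And>x. x \<in> X \<Longrightarrow> f x \<in> simplicial_verts G"
      "\<And>x y. x \<in> X \<Longrightarrow> y \<in> X \<Longrightarrow> separates G x (f x) y"
      by metis
    \<comment> \<open>Antisymmetry is applied with the common value \<open>f x = f y\<close> as
      root: \<open>x\<close> separates it from \<open>y\<close>, and \<open>y\<close> separates it
      from \<open>x\<close>.\<close>
    have "inj_on f X"
    proof (rule inj_onI)
      fix x y assume "x \<in> X" "y \<in> X" "f x = f y"
      moreover from this have "f x \<in> pverts G" "x \<in> pverts G"
        using f(1) XV by (auto simp: simplicial_verts_def)
      ultimately show "x = y"
        using f(2)[of x y] f(2)[of y x] by (intro separates_antisym[of G x "f x" y] connected) auto
    qed
    then show ?thesis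
      using f(1) fin by (intro card_inj_on_le) auto
  qed
qed

theorem mutual_visibility_number_eq: "mutual_visibility_number G = card (simplicial_verts G)"
  unfolding mutual_visibility_number_def
  using mutual_visibility_cards(1)[OF pair_graph] mutual_visibility_set_simplicial
    card_mutual_visibility_set_le
  by (intro Max_eqI) auto

end

section \<open>Trees and their line graphs\<close>

lemma in_edges_iff: "{u, v} \<in> edges G \<longleftrightarrow> (u, v) \<in> parcs G \<or> (v, u) \<in> parcs G"
  by (auto simp: edges_def doubleton_eq_iff)

lemma line_graph_simps [simp]:
  "pverts (line_graph G) = edges G"
  "(e, f) \<in> parcs (line_graph G) \<longleftrightarrow> e \<in> edges G \<and> f \<in> edges G \<and> e \<noteq> f \<and> e \<inter> f \<noteq> {}"
  by (auto simp: line_graph_def)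

locale nontrivial_tree =
  fixes T :: "'a pair_pre_digraph"
  assumes tree: "undirected_tree T" and two_edges: "2 \<le> card (edges T)"
begin

sublocale pair_graph T
  using tree by (simp add: undirected_tree_def)

section \<open>Trees as block graphs\<close>

lemma edge_endpoints:
  assumes "e \<in> edges T"
  shows "\<exists>u v. e = {u, v} \<and> (u, v) \<in> parcs T \<and> u \<noteq> v"
  using assms no_loops' unfolding edges_def by blast

lemma edge_iff: "{u, v} \<in> edges T \<longleftrightarrow> (u, v) \<in> parcs T"
  using arcs_symmetric by (auto simp: in_edges_iff)

lemma no_undirected_cycle: "\<not> undirected_cycle T c"
  using tree by (simp add: undirected_tree_def)

lemma tree_connected:
  assumes "a \<in> pverts T" and "b \<in> pverts T"
  shows "(a, b) \<in> (parcs T)\<^sup>*"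
proof -
  \<comment> \<open>Connectedness is defined through the symmetrised graph, which for
    \<open>T\<close> has the same arcs.\<close>
  have "parcs (mk_symmetric T) = parcs T"
    using arcs_symmetric by (auto simp: mk_symmetric_def)
  then show ?thesis
    using tree assms rtrancl_on_rtranclI[of a b "pverts (mk_symmetric T)" "parcs (mk_symmetric T)"]
    by (simp add: undirected_tree_def connected_def strongly_connected_def reachable_def
        mk_symmetric_def)
qed

text \<open>A path from \<open>y\<close> to \<open>z\<close> off \<open>x\<close> closes through
  \<open>x\<close> to a cycle; if \<open>y \<noteq> z\<close>, the path has at least two vertices
  and the cycle at least three.\<close>

lemma tree_neighbours_eq:
  assumes "(x, y) \<in> parcs T" and "(x, z) \<in> parcs T" and "(y, z) \<in> (avoiding T x)\<^sup>*"
  shows "y = z"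
proof (rule ccontr)
  assume "y \<noteq> z"
  obtain p where p: "vpath p T" "hd p = y" "last p = z" "set p \<subseteq> insert y (Range (avoiding T x))"
    using rtrancl_imp_vpath[OF assms(3) avoiding_subset] pair_wf_digraph assms(1) in_arcsD2
    by metis
  then have "x \<notin> set p"
    using assms(1) no_loops' by (auto simp: avoiding_def)
  moreover have "p \<noteq> []"
    using p by (auto simp: vpath_def vwalk_def)
  moreover have "2 \<le> length p"
    using p \<open>y \<noteq> z\<close> \<open>p \<noteq> []\<close> by (cases p; cases "tl p") auto
  ultimately have "undirected_cycle T (x # p)"
    using p assms in_arcsD1 arcs_symmetric
    by (auto simp: undirected_cycle_def vpath_def intro: vwalk_consI)
  then show False
    using no_undirected_cycle by blast
qed

lemma no_triangle:
  assumes "(x, y) \<in> parcs T" and "(x, z) \<in> parcs T"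
  shows "(y, z) \<notin> parcs T"
proof
  assume "(y, z) \<in> parcs T"
  then have "(y, z) \<in> (avoiding T x)\<^sup>*" and "y \<noteq> z"
    using assms no_loops' by (auto simp: avoiding_def)
  then show False
    using tree_neighbours_eq assms by blast
qed

lemma card_verts: "2 \<le> card (pverts T)"
proof -
  have "edges T \<noteq> {}"
    using two_edges by auto
  then obtain u v where uv: "(u, v) \<in> parcs T" "u \<noteq> v"
    using edge_endpoints by blast
  then have "card {u, v} \<le> card (pverts T)"
    using pair_finite_verts in_arcsD1 in_arcsD2 by (intro card_mono) auto
  with uv show ?thesis by simp
qed

text \<open>\<open>neighbours_adjacent\<close> holds vacuously, since neighbours of \<open>x\<close>
  joined off \<open>x\<close> coincide.\<close>

lemma block_graph_tree: "block_graph T"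
  using tree_connected tree_neighbours_eq card_verts by unfold_locales blast+

section \<open>Line graphs of trees as block graphs\<close>

lemma line_graph_connected:
  assumes "e \<in> edges T" and "f \<in> edges T"
  shows "(e, f) \<in> (parcs (line_graph T))\<^sup>*"
proof -
  \<comment> \<open>Induction along a walk in \<open>T\<close>, whose consecutive edges meet;
    \<open>f\<close> stays arbitrary so that the hypothesis applies to the edge
    \<open>{b, c}\<close> just traversed.\<close>
  have *: "(e, f) \<in> (parcs (line_graph T))\<^sup>*"
    if "(a, b) \<in> (parcs T)\<^sup>*" "a \<in> e" "e \<in> edges T" "b \<in> f" "f \<in> edges T" for a b e f
    using that
  proof (induction arbitrary: f rule: rtrancl_induct)
    case base
    then have "e = f \<or> (e, f) \<in> parcs (line_graph T)"
      unfolding line_graph_simps by blast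
    then show ?case by (metis r_into_rtrancl rtrancl.rtrancl_refl)
  next
    case (step b c)
    have g: "{b, c} \<in> edges T"
      using step by (simp add: edge_iff)
    then have "(e, {b, c}) \<in> (parcs (line_graph T))\<^sup>*"
      using step by simp
    moreover have "{b, c} = f \<or> ({b, c}, f) \<in> parcs (line_graph T)"
      using g step.prems unfolding line_graph_simps by blast
    ultimately show ?case by (metis rtrancl.rtrancl_into_rtrancl)
  qed
  obtain u u' v v' where "e = {u, u'}" "(u, u') \<in> parcs T" "f = {v, v'}" "(v, v') \<in> parcs T"
    using assms[THEN edge_endpoints] by blast
  then show ?thesis
    using *[of u v] assms tree_connected in_arcsD1 by blast
qed

text \<open>Disjoint \<open>f\<close> and \<open>g\<close> meet \<open>e\<close> in its two
  different ends. A walk of edges from \<open>f\<close> to \<open>g\<close> avoiding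
  \<open>e\<close> joins these ends in \<open>T\<close> without \<open>e\<close>, and
  \<open>e\<close> closes a cycle.\<close>

lemma line_graph_neighbours_adjacent:
  assumes "(e, f) \<in> parcs (line_graph T)" and "(e, g) \<in> parcs (line_graph T)"
    and "(f, g) \<in> (avoiding (line_graph T) e)\<^sup>*"
  shows "f \<inter> g \<noteq> {}"
proof
  assume disj: "f \<inter> g = {}"
  define Q where "Q = {(a, b) \<in> parcs T. {a, b} \<noteq> e}"
  have edge: "(a, b) \<in> Q\<^sup>*" if "h \<in> edges T" "h \<noteq> e" "a \<in> h" "b \<in> h" for a b h
  proof -
    obtain s t where "h = {s, t}" "(s, t) \<in> parcs T"
      using edge_endpoints[OF \<open>h \<in> edges T\<close>] by blast
    then show ?thesis
      using that arcs_symmetric by (auto simp: Q_def insert_commute)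
  qed
  have conn: "\<forall>a\<in>f. \<forall>b\<in>g. (a, b) \<in> Q\<^sup>*"
    using assms(3)
  proof induction
    case base
    then show ?case using assms(1) edge by auto
  next
    case (step g h)
    then have h: "h \<in> edges T" "h \<noteq> e" "g \<inter> h \<noteq> {}"
      by (auto simp: avoiding_def)
    then obtain c where "c \<in> g" "c \<in> h" by blast
    with step.IH edge[OF h(1,2)] show ?case by (meson rtrancl_trans)
  qed
  obtain s t where st: "s \<in> e" "s \<in> f" "t \<in> e" "t \<in> g"
    using assms(1,2) by auto
  with disj have "s \<noteq> t" by blast
  obtain u v where uv: "e = {u, v}" "(u, v) \<in> parcs T"
    using assms(1) edge_endpoints by (metis line_graph_simps(2))
  then have e: "e = {s, t}" "(s, t) \<in> parcs T"
    using st \<open>s \<noteq> t\<close> arcs_symmetric by auto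
  have "Q \<subseteq> parcs T"
    by (auto simp: Q_def)
  then obtain p where p: "vpath p T" "hd p = s" "last p = t" "set (vwalk_arcs p) \<subseteq> Q"
    using rtrancl_imp_vpath[of s t Q T] conn st pair_wf_digraph e(2) in_arcsD1 by metis
  have "p \<noteq> []"
    using p by (auto simp: vpath_def vwalk_def)
  then obtain p' where p': "p = s # p'"
    using p by (cases p) auto
  with p \<open>s \<noteq> t\<close> obtain a p'' where "p' = a # p''"
    by (cases p') auto
  \<comment> \<open>\<open>Q\<close> excludes the arc \<open>(s, t)\<close> itself, so the path has
    an inner vertex.\<close>
  with p p' e have "3 \<le> length p"
    by (cases p'') (auto simp: Q_def)
  then have "undirected_cycle T p"
    using p e arcs_symmetric by (auto simp: undirected_cycle_def)
  then show False
    using no_undirected_cycle by blast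
qed

lemma block_graph_line_graph: "block_graph (line_graph T)"
proof (intro block_graph.intro block_graph_axioms.intro pair_graph_line_graph)
  show "pair_graph T"
    by (rule pair_graph)
  show "2 \<le> card (pverts (line_graph T))"
    using two_edges by simp
  show "(e, f) \<in> (parcs (line_graph T))\<^sup>*"
    if "e \<in> pverts (line_graph T)" "f \<in> pverts (line_graph T)" for e f
    using line_graph_connected that unfolding line_graph_simps by blast
  show "(f, g) \<in> parcs (line_graph T)"
    if "(e, f) \<in> parcs (line_graph T)" "(e, g) \<in> parcs (line_graph T)"
      "(f, g) \<in> (avoiding (line_graph T) e)\<^sup>*" "f \<noteq> g" for e f g
    using line_graph_neighbours_adjacent[OF that(1-3)] that(1,2,4)
    unfolding line_graph_simps by blast
qed

section \<open>Leaves and pendant edges\<close>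

lemma simplicial_verts_tree:
  "x \<in> simplicial_verts T \<longleftrightarrow> (\<exists>y. \<forall>z. (x, z) \<in> parcs T \<longleftrightarrow> z = y)"
proof
  assume x: "x \<in> simplicial_verts T"
  \<comment> \<open>A second vertex and connectedness give \<open>x\<close> a neighbour; the absence
    of triangles then leaves only one.\<close>
  obtain b where b: "b \<in> pverts T" "b \<noteq> x"
    using card_verts pair_finite_verts
    by (metis card_le_Suc0_iff_eq not_less_eq_eq numeral_2_eq_2)
  then have "(x, b) \<in> (parcs T)\<^sup>*"
    using x tree_connected by (auto simp: simplicial_verts_def)
  then obtain y where "(x, y) \<in> parcs T"
    using b by (metis converse_rtranclE)
  then show "\<exists>y. \<forall>z. (x, z) \<in> parcs T \<longleftrightarrow> z = y"
    using x no_triangle[of x] unfolding simplicial_verts_def by blast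
next
  assume "\<exists>y. \<forall>z. (x, z) \<in> parcs T \<longleftrightarrow> z = y"
  then show "x \<in> simplicial_verts T"
    using in_arcsD1 by (auto simp: simplicial_verts_def)
qed

text \<open>If neither end is a leaf, further edges at \<open>u\<close> and at \<open>v\<close> are
  disjoint, as there is no triangle. If \<open>u\<close> is a leaf, all edges adjacent to
  \<open>{u, v}\<close> share \<open>v\<close>.\<close>

lemma simplicial_verts_line_graph:
  assumes "(u, v) \<in> parcs T"
  shows "{u, v} \<in> simplicial_verts (line_graph T) \<longleftrightarrow>
    u \<in> simplicial_verts T \<or> v \<in> simplicial_verts T"
proof
  assume simp: "{u, v} \<in> simplicial_verts (line_graph T)"
  show "u \<in> simplicial_verts T \<or> v \<in> simplicial_verts T"
  proof (rule ccontr)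
    assume "\<not> (u \<in> simplicial_verts T \<or> v \<in> simplicial_verts T)"
    then obtain a b where ab: "(u, a) \<in> parcs T" "a \<noteq> v" "(v, b) \<in> parcs T" "b \<noteq> u"
      using assms arcs_symmetric unfolding simplicial_verts_tree by metis
    have ne: "u \<noteq> v" "a \<noteq> u" "b \<noteq> v"
      using assms ab no_loops' by blast+
    have "a \<noteq> b"
      using no_triangle[of u v a] assms ab by blast
    have "({u, v}, {u, a}) \<in> parcs (line_graph T)" "({u, v}, {v, b}) \<in> parcs (line_graph T)"
      using assms ab ne by (auto simp: edge_iff doubleton_eq_iff)
    then have "{u, a} = {v, b} \<or> ({u, a}, {v, b}) \<in> parcs (line_graph T)"
      using simp unfolding simplicial_verts_def by blast
    then show False
      using ne ab \<open>a \<noteq> b\<close> by (auto simp: doubleton_eq_iff)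
  qed
next
  have leaf: "{u, v} \<in> simplicial_verts (line_graph T)"
    if uv: "(u, v) \<in> parcs T" and u: "u \<in> simplicial_verts T" for u v
  proof -
    have nb: "w = v" if "(u, w) \<in> parcs T" for w
      using u uv that by (auto simp: simplicial_verts_tree)
    have "v \<in> f" if "({u, v}, f) \<in> parcs (line_graph T)" for f
    proof (rule ccontr)
      assume "v \<notin> f"
      with that have "u \<in> f" by auto
      from that have "f \<in> edges T" by simp
      then obtain a b where "f = {a, b}" "(a, b) \<in> parcs T"
        using edge_endpoints by metis
      with \<open>u \<in> f\<close> have "v \<in> f"
        using nb arcs_symmetric by auto
      with \<open>v \<notin> f\<close> show False by blast
    qed
    then show ?thesis
      using uv by (fastforce simp: simplicial_verts_def edge_iff)
  qed
  assume "u \<in> simplicial_verts T \<or> v \<in> simplicial_verts T"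
  then show "{u, v} \<in> simplicial_verts (line_graph T)"
    using leaf[of u v] leaf[of v u] assms arcs_symmetric by (auto simp: insert_commute)
qed

text \<open>Two adjacent leaves would make up the whole tree, leaving a single edge. In that
  excluded case two leaves share one pendant edge.\<close>

lemma simplicial_verts_not_adjacent:
  assumes "x \<in> simplicial_verts T" and "y \<in> simplicial_verts T"
  shows "(x, y) \<notin> parcs T"
proof
  assume xy: "(x, y) \<in> parcs T"
  have x: "z = y" if "(x, z) \<in> parcs T" for z
    using assms(1) xy that by (auto simp: simplicial_verts_tree)
  have y: "z = x" if "(y, z) \<in> parcs T" for z
    using assms(2) arcs_symmetric[OF xy] that by (auto simp: simplicial_verts_tree)
  have "z \<in> {x, y}" if "(x, z) \<in> (parcs T)\<^sup>*" for z
    using that by induction (use x y in auto)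
  then have "pverts T \<subseteq> {x, y}"
    using tree_connected in_arcsD1[OF xy] by blast
  have "e = {x, y}" if "e \<in> edges T" for e
  proof -
    obtain a b where ab: "e = {a, b}" "(a, b) \<in> parcs T" "a \<noteq> b"
      using edge_endpoints[OF \<open>e \<in> edges T\<close>] by blast
    with \<open>pverts T \<subseteq> {x, y}\<close> have "a \<in> {x, y}" "b \<in> {x, y}"
      using in_arcsD1 in_arcsD2 by blast+
    with ab show ?thesis by auto
  qed
  then have "edges T \<subseteq> {{x, y}}" by blast
  then have "card (edges T) \<le> 1"
    using card_mono[of "{{x, y}}" "edges T"] by simp
  with two_edges show False by simp
qed

lemma card_simplicial_verts:
  "card (simplicial_verts (line_graph T)) = card (simplicial_verts T)"
proof -
  \<comment> \<open>\<open>n\<close> picks the only neighbour of each leaf, so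
    \<open>{x, n x}\<close> is its pendant edge.\<close>
  obtain n where n: "\<And>x z. x \<in> simplicial_verts T \<Longrightarrow> (x, z) \<in> parcs T \<longleftrightarrow> z = n x"
    using simplicial_verts_tree by metis
  have "bij_betw (\<lambda>x. {x, n x}) (simplicial_verts T) (simplicial_verts (line_graph T))"
  proof (rule bij_betw_imageI)
    \<comment> \<open>Different leaves with the same pendant edge would be adjacent.\<close>
    show "inj_on (\<lambda>x. {x, n x}) (simplicial_verts T)"
      using n simplicial_verts_not_adjacent by (auto simp: inj_on_def doubleton_eq_iff)
    have "\<exists>x\<in>simplicial_verts T. e = {x, n x}" if e: "e \<in> simplicial_verts (line_graph T)" for e
    proof -
      have "e \<in> edges T"
        using e by (simp add: simplicial_verts_def)
      then obtain u v where uv: "e = {u, v}" "(u, v) \<in> parcs T"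
        using edge_endpoints by metis
      then have "u \<in> simplicial_verts T \<or> v \<in> simplicial_verts T"
        using e simplicial_verts_line_graph by blast
      then show ?thesis
        using uv n arcs_symmetric by (metis insert_commute)
    qed
    then show "(\<lambda>x. {x, n x}) ` simplicial_verts T = simplicial_verts (line_graph T)"
      using n simplicial_verts_line_graph by auto
  qed
  then show ?thesis
    by (simp add: bij_betw_same_card)
qed

end

theorem theorem12:
  fixes T :: "'a pair_pre_digraph"
  assumes "undirected_tree T"
    and "card (edges T) \<ge> 2"
  shows "mutual_visibility_number (line_graph T) = mutual_visibility_number T"
proof -
  interpret nontrivial_tree T
    using assms by unfold_locales
  show ?thesis
    using block_graph.mutual_visibility_number_eq[OF block_graph_tree]
      block_graph.mutual_visibility_number_eq[OF block_graph_line_graph]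
    by (simp add: card_simplicial_verts)
qed

end
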